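(* Assume rewards lie in $[0,1]$ and the user-task distribution is agent-independent. Fix $\delta^->0$ and write $B_k=1-(1-Z_k)\delta^-$. (i) Allow the composition map $(M,C)\mapsto A$ from agent states to kernels to be any measurable map. For every $Z\in(0,1)$ and every $u$ with $0<u\le\min\{Z/2,(1-Z)\delta^-\}$, there exists an instance with two user tasks, with $Z_k=Z$, $J_{\mathrm{user}}(A_k)=1-u\ge B_k$, and a modification whose candidate agent $\widetilde A$ satisfies $$D_R^-(\widetilde A;A_k)=0,\qquad M_{A_k}(\widetilde A)=L_{A_k}(\widetilde A)=u/2>0 .$$ (ii) For every current agent $A_k$ with $0<Z_k<1$ and every candidate agent $\widetilde A$, $$M_{A_k}(\widetilde A)\le L_{A_k}(\widetilde A)\le Z_k\bar a_k\le 1-J_{\mathrm{user}}(A_k).$$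
   Context: Tasks $\mathcal T_{\mathrm{user}}$ and outputs $\mathcal O$ are measurable spaces; an agent is a Markov kernel $A(\cdot\mid t)$ from tasks to outputs; reward $r(t,o)\in[0,1]$ and failure detector $\phi(t,o)\in\{0,1\}$ are measurable; $\mathcal D_{\mathrm{user}}$ is a fixed probability measure on user tasks. An agent state is a pair $(M,C)$ of a frozen model $M$ and a code state $C$; a modification $c$ turns $C_k$ into $C_k\oplus c$, and the composition map sends each state to a Markov kernel; the current agent is the kernel at $(M,C_k)$ and the candidate $\widetilde A=A_k\oplus c$ the kernel at $(M,C_k\oplus c)$. (An agent also acts as a kernel on separate self-modification tasks $t_F$ encoding failure material $F$, with generation kernel $\Pi_k(\cdot\mid F)=A_k(\cdot\mid t_F)$; this places no restriction on user-task behaviour.) $V(A,t)=\int r(t,o)A(do\mid t)$, $J_{\mathrm{user}}(A)=\mathbb E_{t\sim\mathcal D_{\mathrm{user}}}V(A,t)$, $\psi_A(t)=\int\phi(t,o)A(do\mid t)$, $Z_k=\mathbb E_{\mathcal D_{\mathrm{user}}}\psi_{A_k}$, $\mathcal D_{F,k}(dt)=\frac{\psi_{A_k}(t)}{Z_k}\mathcal D_{\mathrm{user}}(dt)$, $\mathcal D_{R,k}(dt)=\frac{1-\psi_{A_k}(t)}{1-Z_k}\mathcal D_{\mathrm{user}}(dt)$. $L_{A_k}(\widetilde A)=Z_k\mathbb E_{t\sim\mathcal D_{F,k}}[V(\widetilde A,t)-V(A_k,t)]$, $D_R^-(\widetilde A;A_k)=\mathbb E_{t\sim\mathcal D_{R,k}}[(V(A_k,t)-V(\widetilde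 A,t))_+]$, $M_{A_k}(\widetilde A)=L_{A_k}(\widetilde A)-(1-Z_k)D_R^-(\widetilde A;A_k)$, $\bar a_k=1-\mathbb E_{t\sim\mathcal D_{F,k}}[V(A_k,t)]$. *)

theory Defs
  imports "HOL-Probability.Probability"
begin

text \<open>
  A Markov kernel from \<open>T\<close> to \<open>Out\<close> is a function \<open>A :: 't \<Rightarrow> 'o measure\<close> that is measurable
  into the space of probability measures on \<open>Out\<close>. Its values off \<open>space T\<close> are irrelevant.
\<close>

abbreviation markov_kernels :: "'t measure \<Rightarrow> 'o measure \<Rightarrow> ('t \<Rightarrow> 'o measure) set" where
  "markov_kernels T Out \<equiv> T \<rightarrow>\<^sub>M prob_algebra Out"

text \<open>
  The set of kernels carries the coarsest sigma-algebra that makes all evaluations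
  \<open>A \<mapsto> A(\<cdot> | t)\<close> measurable.
\<close>

definition kernel_space :: "'t measure \<Rightarrow> 'o measure \<Rightarrow> ('t \<Rightarrow> 'o measure) measure" where
  "kernel_space T Out = sigma (markov_kernels T Out)
     {{A \<in> markov_kernels T Out. A t \<in> W} | t W. t \<in> space T \<and> W \<in> sets (prob_algebra Out)}"

locale user_environment =
  fixes T :: "'t measure"
    and Out :: "'o measure"
    and r :: "'t \<Rightarrow> 'o \<Rightarrow> real"
    and \<phi> :: "'t \<Rightarrow> 'o \<Rightarrow> real"
    and D :: "'t measure"
  assumes user_distribution: "D \<in> space (prob_algebra T)"
    and reward_measurable: "(\<lambda>(t, x). r t x) \<in> borel_measurable (T \<Otimes>\<^sub>M Out)"
    and reward_range: "\<And>t x. t \<in> space T \<Longrightarrow> x \<in> space Out \<Longrightarrow> r t x \<in> {0..1}"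
    and detector_measurable: "(\<lambda>(t, x). \<phi> t x) \<in> borel_measurable (T \<Otimes>\<^sub>M Out)"
    and detector_range: "\<And>t x. t \<in> space T \<Longrightarrow> x \<in> space Out \<Longrightarrow> \<phi> t x \<in> {0, 1}"

text \<open>
  \<open>Mdl\<close> and \<open>Code\<close> are the spaces of models and code states, \<open>upd C c\<close> is the code state
  obtained from \<open>C\<close> by the modification \<open>c \<in> Mods\<close>, and \<open>cmp\<close> is the composition map from
  agent states to kernels, subject to measurability only.
\<close>

locale agent_system = user_environment T Out r \<phi> D
  for T :: "'t measure" and Out :: "'o measure" and r \<phi> :: "'t \<Rightarrow> 'o \<Rightarrow> real" and D :: "'t measure" +
  fixes Mdl :: "'m measure"
    and Code :: "'c measure"
    and Mods :: "'d set"
    and upd :: "'c \<Rightarrow> 'd \<Rightarrow> 'c"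
    and cmp :: "'m \<times> 'c \<Rightarrow> 't \<Rightarrow> 'o measure"
  assumes update_closed: "\<And>C c. C \<in> space Code \<Longrightarrow> c \<in> Mods \<Longrightarrow> upd C c \<in> space Code"
    and composition_measurable: "cmp \<in> (Mdl \<Otimes>\<^sub>M Code) \<rightarrow>\<^sub>M kernel_space T Out"

definition V :: "('t \<Rightarrow> 'o \<Rightarrow> real) \<Rightarrow> ('t \<Rightarrow> 'o measure) \<Rightarrow> 't \<Rightarrow> real" where
  "V r A t = (\<integral>x. r t x \<partial>A t)"

definition J_user :: "('t \<Rightarrow> 'o \<Rightarrow> real) \<Rightarrow> 't measure \<Rightarrow> ('t \<Rightarrow> 'o measure) \<Rightarrow> real" where
  "J_user r D A = (\<integral>t. V r A t \<partial>D)"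

definition fail_prob :: "('t \<Rightarrow> 'o \<Rightarrow> real) \<Rightarrow> ('t \<Rightarrow> 'o measure) \<Rightarrow> 't \<Rightarrow> real" where
  "fail_prob \<phi> A t = (\<integral>x. \<phi> t x \<partial>A t)"

definition fail_mass :: "('t \<Rightarrow> 'o \<Rightarrow> real) \<Rightarrow> 't measure \<Rightarrow> ('t \<Rightarrow> 'o measure) \<Rightarrow> real" where
  "fail_mass \<phi> D A = (\<integral>t. fail_prob \<phi> A t \<partial>D)"

text \<open>
  The failure and retention distributions are only meaningful when \<open>fail_mass \<phi> D A\<close> lies
  strictly between 0 and 1.
\<close>

definition fail_dist :: "('t \<Rightarrow> 'o \<Rightarrow> real) \<Rightarrow> 't measure \<Rightarrow> ('t \<Rightarrow> 'o measure) \<Rightarrow> 't measure" where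
  "fail_dist \<phi> D A = density D (\<lambda>t. ennreal (fail_prob \<phi> A t / fail_mass \<phi> D A))"

definition retain_dist :: "('t \<Rightarrow> 'o \<Rightarrow> real) \<Rightarrow> 't measure \<Rightarrow> ('t \<Rightarrow> 'o measure) \<Rightarrow> 't measure" where
  "retain_dist \<phi> D A = density D (\<lambda>t. ennreal ((1 - fail_prob \<phi> A t) / (1 - fail_mass \<phi> D A)))"

text \<open>
  In the following, \<open>A\<close> is the current agent and \<open>A'\<close> the candidate:
  \<open>learning_gain\<close>, \<open>retention_loss\<close>, \<open>margin\<close>, \<open>failure_gap\<close> and \<open>threshold\<close> are
  \<open>L\<^sub>A(A')\<close>, \<open>D\<^sub>R\<^sup>-(A'; A)\<close>, \<open>M\<^sub>A(A')\<close>, \<open>a\<close>-bar and \<open>B\<close>.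
\<close>

definition learning_gain ::
  "('t \<Rightarrow> 'o \<Rightarrow> real) \<Rightarrow> ('t \<Rightarrow> 'o \<Rightarrow> real) \<Rightarrow> 't measure \<Rightarrow> ('t \<Rightarrow> 'o measure) \<Rightarrow> ('t \<Rightarrow> 'o measure) \<Rightarrow> real" where
  "learning_gain r \<phi> D A A' = fail_mass \<phi> D A * (\<integral>t. V r A' t - V r A t \<partial>fail_dist \<phi> D A)"

definition retention_loss ::
  "('t \<Rightarrow> 'o \<Rightarrow> real) \<Rightarrow> ('t \<Rightarrow> 'o \<Rightarrow> real) \<Rightarrow> 't measure \<Rightarrow> ('t \<Rightarrow> 'o measure) \<Rightarrow> ('t \<Rightarrow> 'o measure) \<Rightarrow> real" where
  "retention_loss r \<phi> D A A' = (\<integral>t. max 0 (V r A t - V r A' t) \<partial>retain_dist \<phi> D A)"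

definition margin ::
  "('t \<Rightarrow> 'o \<Rightarrow> real) \<Rightarrow> ('t \<Rightarrow> 'o \<Rightarrow> real) \<Rightarrow> 't measure \<Rightarrow> ('t \<Rightarrow> 'o measure) \<Rightarrow> ('t \<Rightarrow> 'o measure) \<Rightarrow> real" where
  "margin r \<phi> D A A' =
     learning_gain r \<phi> D A A' - (1 - fail_mass \<phi> D A) * retention_loss r \<phi> D A A'"

definition failure_gap ::
  "('t \<Rightarrow> 'o \<Rightarrow> real) \<Rightarrow> ('t \<Rightarrow> 'o \<Rightarrow> real) \<Rightarrow> 't measure \<Rightarrow> ('t \<Rightarrow> 'o measure) \<Rightarrow> real" where
  "failure_gap r \<phi> D A = 1 - (\<integral>t. V r A t \<partial>fail_dist \<phi> D A)"

definition threshold ::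
  "('t \<Rightarrow> 'o \<Rightarrow> real) \<Rightarrow> 't measure \<Rightarrow> ('t \<Rightarrow> 'o measure) \<Rightarrow> real \<Rightarrow> real" where
  "threshold \<phi> D A \<delta> = 1 - (1 - fail_mass \<phi> D A) * \<delta>"

end

theory Submission
  imports Defs
begin

text \<open>
  Reweighting by \<open>\<psi>\<^sub>A / Z\<close> turns the learning gain into \<open>\<integral> \<psi>\<^sub>A (V\<^sub>A\<^sub>' - V\<^sub>A) dD\<close>, so part (ii) is a pointwise
  comparison with \<open>\<psi>\<^sub>A (1 - V\<^sub>A) \<le> 1 - V\<^sub>A\<close>. For part (i) the agent ignores the task and always outputs
  its code state: task 0 always fails, task 1 is always solved with reward 1, and on task 0
  the outputs 0 and 1 earn \<open>1 - u / Z\<close> and \<open>1 - u / (2 Z)\<close>.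
\<close>

section \<open>Integration against a Markov kernel\<close>

text \<open>An average of a [0,1]-valued function against a probability measure stays in [0,1]. The
  statement is generic in \<open>f\<close> because it serves both the reward and the
  detector.\<close>

lemma integral_kernel_unit_interval:
  assumes A: "A \<in> markov_kernels T Out" and t: "t \<in> space T"
    and f: "(\<lambda>(t, x). f t x) \<in> borel_measurable (T \<Otimes>\<^sub>M Out)"
    and range: "\<And>x. x \<in> space Out \<Longrightarrow> f t x \<in> {0..1::real}"
  shows "(\<integral>x. f t x \<partial>A t) \<in> {0..1}"
proof -
  have At: "A t \<in> space (prob_algebra Out)"
    using measurable_space[OF A t] .
  then interpret prob_space "A t"
    by (simp add: space_prob_algebra)
  have sets: "sets (A t) = sets Out"
    using At by (simp add: space_prob_algebra)
  then have sp: "space (A t) = space Out"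
    by (rule sets_eq_imp_space_eq)
  have "(\<lambda>x. f t x) \<in> borel_measurable Out"
    using measurable_compose[OF measurable_Pair1'[OF t] f] by simp
  then have meas: "(\<lambda>x. f t x) \<in> borel_measurable (A t)"
    using sets by (simp cong: measurable_cong_sets)
  have int: "integrable (A t) (\<lambda>x. f t x)"
    using range sp by (intro integrable_const_bound[where B = 1] meas) auto
  have "(\<integral>x. f t x \<partial>A t) \<ge> 0"
    using range sp by (intro integral_nonneg_AE) auto
  moreover have "(\<integral>x. f t x \<partial>A t) \<le> 1"
    using range sp by (intro integral_le_const int) auto
  ultimately show ?thesis by simp
qed

text \<open>The integrand varies with \<open>x\<close>, so measurability of integration against a
  fixed function does not apply directly. Pushing \<open>L x\<close> forward along \<open>y\<close>
  \<mapsto> \<open>(x, y)\<close> moves this dependence into the measure, and the integrand becomes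
  one fixed function on the product space.\<close>

lemma integral_kernel_measurable:
  fixes f :: "'a \<Rightarrow> 'b \<Rightarrow> real"
  assumes f [measurable]: "(\<lambda>(x, y). f x y) \<in> borel_measurable (M \<Otimes>\<^sub>M N)"
    and L: "L \<in> M \<rightarrow>\<^sub>M subprob_algebra N"
  shows "(\<lambda>x. \<integral>y. f x y \<partial>L x) \<in> borel_measurable M"
proof -
  note measurable_distr2[measurable] and L[measurable]
  have "(\<lambda>x. integral\<^sup>L (distr (L x) (M \<Otimes>\<^sub>M N) (\<lambda>y. (x, y))) (\<lambda>(x, y). f x y)) \<in> borel_measurable M"
    by measurable
  then show ?thesis
    by (rule measurable_cong[THEN iffD1, rotated])
      (use f measurable_space[OF L] in \<open>auto simp: integral_distr sets_kernel[OF L]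
        cong: measurable_cong_sets\<close>)
qed

section \<open>Upper bounds on margin and learning gain in an arbitrary environment\<close>

context user_environment
begin

lemma sets_D: "sets D = sets T"
  using user_distribution by (simp add: space_prob_algebra)

lemma space_D: "space D = space T"
  using sets_D by (rule sets_eq_imp_space_eq)

lemma prob_space_D: "prob_space D"
  using user_distribution by (simp add: space_prob_algebra)

lemma V_range:
  assumes "A \<in> markov_kernels T Out" "t \<in> space T"
  shows "V r A t \<in> {0..1}"
  unfolding V_def
  by (rule integral_kernel_unit_interval[OF assms reward_measurable]) (rule reward_range[OF assms(2)])

lemma fail_prob_range:
  assumes "A \<in> markov_kernels T Out" "t \<in> space T"
  shows "fail_prob \<phi> A t \<in> {0..1}"
  unfolding fail_prob_def
  by (rule integral_kernel_unit_interval[OF assms detector_measurable])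
    (use detector_range[OF assms(2)] in fastforce)

lemma V_measurable:
  assumes "A \<in> markov_kernels T Out"
  shows "V r A \<in> borel_measurable D"
proof -
  have "(\<lambda>t. V r A t) \<in> borel_measurable T"
    unfolding V_def
    by (rule integral_kernel_measurable[OF reward_measurable measurable_prob_algebraD[OF assms]])
  then show ?thesis by (simp cong: measurable_cong_sets add: sets_D)
qed

lemma fail_prob_measurable:
  assumes "A \<in> markov_kernels T Out"
  shows "fail_prob \<phi> A \<in> borel_measurable D"
proof -
  have "(\<lambda>t. fail_prob \<phi> A t) \<in> borel_measurable T"
    unfolding fail_prob_def
    by (rule integral_kernel_measurable[OF detector_measurable measurable_prob_algebraD[OF assms]])
  then show ?thesis by (simp cong: measurable_cong_sets add: sets_D)
qed

text \<open>The prefactor cancels the normalising constant of the density, which is nonnegative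
  because failure probabilities are. Later estimates can then be made pointwise under
  \<open>D\<close>.\<close>

lemma fail_dist_integral:
  assumes A: "A \<in> markov_kernels T Out" and Z: "0 < fail_mass \<phi> D A"
    and f: "f \<in> borel_measurable D"
  shows "fail_mass \<phi> D A * (\<integral>t. f t \<partial>fail_dist \<phi> D A) = (\<integral>t. fail_prob \<phi> A t * f t \<partial>D)"
proof -
  have "(\<integral>t. f t \<partial>fail_dist \<phi> D A) = (\<integral>t. (fail_prob \<phi> A t / fail_mass \<phi> D A) * f t \<partial>D)"
    unfolding fail_dist_def using fail_prob_range[OF A] Z
    by (intro integral_real_density f borel_measurable_divide fail_prob_measurable[OF A])
      (auto simp: space_D intro!: AE_I2)
  then show ?thesis
    using Z by simp
qed

lemma learning_gain_eq:
  assumes "A \<in> markov_kernels T Out" "A' \<in> markov_kernels T Out" "0 < fail_mass \<phi> D A"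
  shows "learning_gain r \<phi> D A A' = (\<integral>t. fail_prob \<phi> A t * (V r A' t - V r A t) \<partial>D)"
  unfolding learning_gain_def
  by (rule fail_dist_integral) (use assms V_measurable in auto)

text \<open>The bound 1 suffices throughout: the integrands are built from values, failure
  probabilities and differences of values, all of modulus at most 1, and products of these.\<close>

lemma integrable_bounded:
  assumes "f \<in> borel_measurable D" "\<And>t. t \<in> space T \<Longrightarrow> \<bar>f t\<bar> \<le> (1::real)"
  shows "integrable D f"
proof -
  interpret prob_space D by (rule prob_space_D)
  show ?thesis
    using assms by (intro integrable_const_bound[where B = 1]) (auto simp: space_D)
qed

text \<open>The subtracted penalty is a nonnegative integral with the positive weight
  \<open>1 - fail_mass \<phi> D A\<close>.\<close>

lemma margin_le_learning_gain:
  assumes "fail_mass \<phi> D A < 1"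
  shows "margin r \<phi> D A A' \<le> learning_gain r \<phi> D A A'"
proof -
  have "retention_loss r \<phi> D A A' \<ge> 0"
    unfolding retention_loss_def by (intro integral_nonneg_AE) auto
  then show ?thesis using assms by (simp add: margin_def)
qed

text \<open>The failure mass is itself the integral of the failure probability, so the constant 1 in
  the gap can be brought under the same integral as the value term.\<close>

lemma failure_gap_eq:
  assumes A: "A \<in> markov_kernels T Out" and Z: "0 < fail_mass \<phi> D A"
  shows "fail_mass \<phi> D A * failure_gap r \<phi> D A = (\<integral>t. fail_prob \<phi> A t * (1 - V r A t) \<partial>D)"
proof -
  note [measurable] = V_measurable[OF A] fail_prob_measurable[OF A]
  have int: "integrable D (fail_prob \<phi> A)" "integrable D (\<lambda>t. fail_prob \<phi> A t * V r A t)"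
    using V_range[OF A] fail_prob_range[OF A] by (auto intro!: integrable_bounded simp: abs_mult mult_le_one)
  have "fail_mass \<phi> D A * failure_gap r \<phi> D A
      = (\<integral>t. fail_prob \<phi> A t \<partial>D) - (\<integral>t. fail_prob \<phi> A t * V r A t \<partial>D)"
    using fail_dist_integral[OF A Z V_measurable[OF A]]
    by (simp add: failure_gap_def right_diff_distrib fail_mass_def)
  then show ?thesis
    using int by (simp add: right_diff_distrib)
qed

text \<open>No candidate earns more than 1 on any task; weighting this bound by the nonnegative
  failure probability and integrating gives the claim.\<close>

lemma learning_gain_le_failure_gap:
  assumes A: "A \<in> markov_kernels T Out" and A': "A' \<in> markov_kernels T Out"
    and Z: "0 < fail_mass \<phi> D A"
  shows "learning_gain r \<phi> D A A' \<le> fail_mass \<phi> D A * failure_gap r \<phi> D A"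
proof -
  note [measurable] = V_measurable[OF A] V_measurable[OF A'] fail_prob_measurable[OF A]
  have "(\<integral>t. fail_prob \<phi> A t * (V r A' t - V r A t) \<partial>D) \<le> (\<integral>t. fail_prob \<phi> A t * (1 - V r A t) \<partial>D)"
  proof (rule integral_mono)
    fix t assume "t \<in> space D"
    then show "fail_prob \<phi> A t * (V r A' t - V r A t) \<le> fail_prob \<phi> A t * (1 - V r A t)"
      using V_range[OF A'] fail_prob_range[OF A] by (auto simp: space_D intro!: mult_left_mono)
  qed (use V_range[OF A] V_range[OF A'] fail_prob_range[OF A] in
      \<open>fastforce intro!: integrable_bounded mult_le_one simp: abs_mult abs_le_iff\<close>)+
  then show ?thesis
    using learning_gain_eq[OF A A' Z] failure_gap_eq[OF A Z] by simp
qed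

lemma failure_gap_le_user_gap:
  assumes A: "A \<in> markov_kernels T Out" and Z: "0 < fail_mass \<phi> D A"
  shows "fail_mass \<phi> D A * failure_gap r \<phi> D A \<le> 1 - J_user r D A"
proof -
  interpret prob_space D by (rule prob_space_D)
  note [measurable] = V_measurable[OF A] fail_prob_measurable[OF A]
  have intV: "integrable D (V r A)"
    using V_range[OF A] by (auto intro!: integrable_bounded)
  have "(\<integral>t. fail_prob \<phi> A t * (1 - V r A t) \<partial>D) \<le> (\<integral>t. 1 - V r A t \<partial>D)"
  proof (rule integral_mono)
    fix t assume "t \<in> space D"
    then show "fail_prob \<phi> A t * (1 - V r A t) \<le> 1 - V r A t"
      using V_range[OF A] fail_prob_range[OF A] by (auto simp: space_D intro!: mult_left_le_one_le)
  qed (use V_range[OF A] fail_prob_range[OF A] in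
      \<open>auto intro!: integrable_bounded mult_le_one simp: abs_mult\<close>)
  also have "\<dots> = 1 - J_user r D A"
    using intV by (simp add: J_user_def prob_space)
  finally show ?thesis
    using failure_gap_eq[OF A Z] by simp
qed

end

section \<open>The two-task instance\<close>

definition two_points :: "nat measure" where
  "two_points = count_space {0, 1}"

definition two_task_dist :: "real \<Rightarrow> nat measure" where
  "two_task_dist Z = point_measure {0, 1} (\<lambda>t. ennreal (if t = 0 then Z else 1 - Z))"

text \<open>Task 0 will have probability \<open>Z\<close>, so dividing by \<open>Z\<close> makes
  output 0 cost exactly \<open>u\<close> in expected reward, and output 1 exactly half of
  that.\<close>

definition two_task_reward :: "real \<Rightarrow> real \<Rightarrow> nat \<Rightarrow> nat \<Rightarrow> real" where
  "two_task_reward Z u t x = (if t = 0 then if x = 0 then 1 - u / Z else 1 - u / (2 * Z) else 1)"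

text \<open>Independence of the output makes the failure probability the indicator of task 0, so the
  failure mass is the probability of that task.\<close>

definition two_task_detector :: "nat \<Rightarrow> nat \<Rightarrow> real" where
  "two_task_detector t x = (if t = 0 then 1 else 0)"

definition constant_agent :: "nat \<times> nat \<Rightarrow> nat \<Rightarrow> nat measure" where
  "constant_agent s t = return two_points (snd s)"

lemma space_two_points [simp]: "space two_points = {0, 1}"
  and sets_two_points [simp]: "sets two_points = Pow {0, 1}"
  by (simp_all add: two_points_def)

lemma two_points_pair: "two_points \<Otimes>\<^sub>M two_points = count_space ({0, 1} \<times> {0, 1})"
  unfolding two_points_def by (rule pair_measure_countable) auto

lemma integral_two_task_dist:
  fixes f :: "nat \<Rightarrow> real"
  assumes "0 < Z" "Z < 1"
  shows "(\<integral>t. f t \<partial>two_task_dist Z) = Z * f 0 + (1 - Z) * f 1"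
  unfolding two_task_dist_def
  using assms by (subst lebesgue_integral_point_measure_finite) auto

lemma two_task_dist_prob_algebra:
  assumes "0 < Z" "Z < 1"
  shows "two_task_dist Z \<in> space (prob_algebra two_points)"
proof -
  have "emeasure (two_task_dist Z) {0, 1} = 1"
    unfolding two_task_dist_def using assms
    by (subst emeasure_point_measure_finite) (auto simp flip: ennreal_plus)
  then have "prob_space (two_task_dist Z)"
    by (intro prob_spaceI) (simp add: two_task_dist_def space_point_measure)
  then show ?thesis
    by (simp add: space_prob_algebra two_task_dist_def sets_point_measure)
qed

lemma constant_agent_kernel:
  assumes "snd s \<in> {0, 1}"
  shows "constant_agent s \<in> markov_kernels two_points two_points"
proof -
  have "return two_points (snd s) \<in> space (prob_algebra two_points)"
    using assms by (auto simp: space_prob_algebra intro!: prob_space_return)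
  then show ?thesis
    unfolding constant_agent_def by simp
qed

text \<open>A modification overwrites the code state. All spaces are discrete, so measurability of
  the composition map reduces to its values being kernels.\<close>

lemma two_task_system:
  assumes "0 < Z" "Z < 1" "0 < u" "u \<le> Z / 2"
  shows "agent_system two_points two_points (two_task_reward Z u) two_task_detector (two_task_dist Z)
    two_points two_points {0, 1} (\<lambda>C c. c) constant_agent"
proof
  show "two_task_dist Z \<in> space (prob_algebra two_points)"
    using assms by (intro two_task_dist_prob_algebra)
  show "(\<lambda>(t, x). two_task_reward Z u t x) \<in> borel_measurable (two_points \<Otimes>\<^sub>M two_points)"
    by (simp add: two_points_pair)
  show "(\<lambda>(t, x). two_task_detector t x) \<in> borel_measurable (two_points \<Otimes>\<^sub>M two_points)"
    by (simp add: two_points_pair)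
  \<comment> \<open>The bound \<open>u \<le> Z / 2\<close> keeps both task-0 rewards at 1/2 or
    above.\<close>
  show "two_task_reward Z u t x \<in> {0..1}" for t x
    using assms by (auto simp: two_task_reward_def field_simps)
  show "two_task_detector t x \<in> {0, 1}" for t x
    by (simp add: two_task_detector_def)
  show "constant_agent \<in> (two_points \<Otimes>\<^sub>M two_points) \<rightarrow>\<^sub>M kernel_space two_points two_points"
    using constant_agent_kernel
    by (auto simp: two_points_pair kernel_space_def space_measure_of_conv)
qed simp

lemma constant_agent_integral:
  fixes f :: "nat \<Rightarrow> real"
  assumes "snd s \<in> {0, 1}"
  shows "(\<integral>x. f x \<partial>constant_agent s t) = f (snd s)"
  unfolding constant_agent_def
  by (rule integral_return) (use assms in \<open>auto simp: two_points_def\<close>)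

lemma two_task_instance:
  assumes Z: "0 < Z" "Z < 1" and u: "0 < u" "u \<le> Z / 2"
  defines "A \<equiv> constant_agent (0, 0)" and "A' \<equiv> constant_agent (0, 1)"
    and "r \<equiv> two_task_reward Z u" and "\<phi> \<equiv> two_task_detector" and "D \<equiv> two_task_dist Z"
  shows "fail_mass \<phi> D A = Z" "J_user r D A = 1 - u"
    and "retention_loss r \<phi> D A A' = 0" "learning_gain r \<phi> D A A' = u / 2"
proof -
  interpret agent_system two_points two_points r \<phi> D two_points two_points "{0, 1}" "\<lambda>C c. c"
    constant_agent
    unfolding r_def \<phi>_def D_def by (rule two_task_system[OF Z u])
  have A: "A \<in> markov_kernels two_points two_points" and A': "A' \<in> markov_kernels two_points two_points"
    unfolding A_def A'_def by (auto intro!: constant_agent_kernel)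
  have V: "V r A t = (if t = 0 then 1 - u / Z else 1)"
      "V r A' t = (if t = 0 then 1 - u / (2 * Z) else 1)" for t
    unfolding V_def A_def A'_def
    by (simp_all only: constant_agent_integral insertI1 insertI2 snd_conv r_def two_task_reward_def)
      simp_all
  have \<psi>: "fail_prob \<phi> A t = (if t = 0 then 1 else 0)" for t
    by (subst fail_prob_def)
      (simp only: A_def constant_agent_integral insertI1 snd_conv \<phi>_def two_task_detector_def)
  show mass: "fail_mass \<phi> D A = Z"
    by (simp add: fail_mass_def D_def integral_two_task_dist[OF Z] \<psi>)
  show "J_user r D A = 1 - u"
    using Z by (simp add: J_user_def D_def integral_two_task_dist[OF Z] V field_simps)
  \<comment> \<open>The candidate is at least as good on every task, so the loss integrand vanishes
    identically.\<close>
  have "max 0 (V r A t - V r A' t) = 0" for t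
    using Z u by (auto simp: V field_simps)
  then show "retention_loss r \<phi> D A A' = 0"
    by (simp add: retention_loss_def)
  \<comment> \<open>Only task 0 contributes:
    \<open>Z * (u / Z - u / (2 * Z)) = u / 2\<close>.\<close>
  show "learning_gain r \<phi> D A A' = u / 2"
    unfolding learning_gain_eq[OF A A' Z(1)[folded mass]] unfolding D_def
    using Z by (simp add: integral_two_task_dist[OF Z] \<psi> V field_simps)
qed

theorem proposition19:
  fixes \<delta> :: real
  assumes "\<delta> > 0"
  shows "(\<forall>Z u :: real. 0 < Z \<and> Z < 1 \<and> 0 < u \<and> u \<le> min (Z / 2) ((1 - Z) * \<delta>) \<longrightarrow>
      (\<exists>(T :: nat measure) (Out :: nat measure) r \<phi> D
         (Mdl :: nat measure) (Code :: nat measure) (Mods :: nat set) upd cmp M C c.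
         agent_system T Out r \<phi> D Mdl Code Mods upd cmp \<and>
         card (space T) = 2 \<and> sets T = Pow (space T) \<and>
         M \<in> space Mdl \<and> C \<in> space Code \<and> c \<in> Mods \<and>
         (let A = cmp (M, C); A' = cmp (M, upd C c) in
            fail_mass \<phi> D A = Z \<and>
            J_user r D A = 1 - u \<and> 1 - u \<ge> threshold \<phi> D A \<delta> \<and>
            retention_loss r \<phi> D A A' = 0 \<and>
            margin r \<phi> D A A' = learning_gain r \<phi> D A A' \<and>
            learning_gain r \<phi> D A A' = u / 2 \<and> u / 2 > 0)))
    \<and>
    (\<forall>(T :: 't measure) (Out :: 'o measure) r \<phi> D A A'.
      user_environment T Out r \<phi> D \<longrightarrow>
      A \<in> markov_kernels T Out \<longrightarrow> A' \<in> markov_kernels T Out \<longrightarrow>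
      0 < fail_mass \<phi> D A \<and> fail_mass \<phi> D A < 1 \<longrightarrow>
        margin r \<phi> D A A' \<le> learning_gain r \<phi> D A A' \<and>
        learning_gain r \<phi> D A A' \<le> fail_mass \<phi> D A * failure_gap r \<phi> D A \<and>
        fail_mass \<phi> D A * failure_gap r \<phi> D A \<le> 1 - J_user r D A)"
proof (intro conjI allI impI)
  fix Z u :: real
  assume "0 < Z \<and> Z < 1 \<and> 0 < u \<and> u \<le> min (Z / 2) ((1 - Z) * \<delta>)"
  then have Z: "0 < Z" "Z < 1" and u: "0 < u" "u \<le> Z / 2" and u\<delta>: "u \<le> (1 - Z) * \<delta>"
    by auto
  note inst = two_task_instance[OF Z u]
  show "\<exists>(T :: nat measure) (Out :: nat measure) r \<phi> D
         (Mdl :: nat measure) (Code :: nat measure) (Mods :: nat set) upd cmp M C c.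
         agent_system T Out r \<phi> D Mdl Code Mods upd cmp \<and>
         card (space T) = 2 \<and> sets T = Pow (space T) \<and>
         M \<in> space Mdl \<and> C \<in> space Code \<and> c \<in> Mods \<and>
         (let A = cmp (M, C); A' = cmp (M, upd C c) in
            fail_mass \<phi> D A = Z \<and>
            J_user r D A = 1 - u \<and> 1 - u \<ge> threshold \<phi> D A \<delta> \<and>
            retention_loss r \<phi> D A A' = 0 \<and>
            margin r \<phi> D A A' = learning_gain r \<phi> D A A' \<and>
            learning_gain r \<phi> D A A' = u / 2 \<and> u / 2 > 0)"
    \<comment> \<open>The modification 1 moves the code state from 0 to 1, while the model 0 stays
      fixed. The threshold inequality is a rearrangement of
      \<open>u \<le> (1 - Z) * \<delta>\<close>, and with zero retention loss the margin equals the
      learning gain.\<close>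
    by (rule exI[of _ two_points], rule exI[of _ two_points], rule exI[of _ "two_task_reward Z u"],
        rule exI[of _ two_task_detector], rule exI[of _ "two_task_dist Z"],
        rule exI[of _ two_points], rule exI[of _ two_points], rule exI[of _ "{0, 1}"],
        rule exI[of _ "\<lambda>C c. c"], rule exI[of _ constant_agent],
        rule exI[of _ 0], rule exI[of _ 0], rule exI[of _ 1])
      (use two_task_system[OF Z u] inst u u\<delta> in \<open>simp add: Let_def threshold_def margin_def\<close>)
next
  fix T :: "'t measure" and Out :: "'o measure" and r \<phi> D A A'
  assume env: "user_environment T Out r \<phi> D"
    and A: "A \<in> markov_kernels T Out" "A' \<in> markov_kernels T Out"
    and Z: "0 < fail_mass \<phi> D A \<and> fail_mass \<phi> D A < 1"
  interpret user_environment T Out r \<phi> D by (rule env)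
  show "margin r \<phi> D A A' \<le> learning_gain r \<phi> D A A'"
    using Z by (intro margin_le_learning_gain) simp
  show "learning_gain r \<phi> D A A' \<le> fail_mass \<phi> D A * failure_gap r \<phi> D A"
    using Z A by (intro learning_gain_le_failure_gap) simp_all
  show "fail_mass \<phi> D A * failure_gap r \<phi> D A \<le> 1 - J_user r D A"
    using Z A by (intro failure_gap_le_user_gap) simp_all
qed

end
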